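(* Let $m,n\ge 1$ be integers and consider the warden's game played with $n$ dice, each with $m$ sides. Then there is exactly one position of each remoteness from $0$ to $m^n$, and the position with the largest remoteness $m^n$ is the position of all $(m-1)$'s. Here the goal position (all $(m-1)$'s) is counted both as an ending position, with remoteness $0$, and as a starting position, with positive remoteness. Equivalently: for every integer $j$ with $1\le j\le m^n$ there is exactly one position $\beta$ with $r(\beta)=j$, and the goal position $\gamma$ satisfies $r(\gamma)=m^n$.
   Context: The warden's game with $n$ $m$-sided dice: a position is a string $x_1x_2\ldots x_n$ with each $x_i\in\{0,1,\ldots,m-1\}$. There are two players, the prisoner and the warden, both with full information. In each move the rightmost die is transferred to the far left, possibly with a changed value, so that $x_1\ldots x_n$ becomes $c\,x_1\ldots x_{n-1}$ for some $c$ determined as follows. The warden first chooses either (i) to transfer the die himself, strictly decreasing its value, i.e. he chooses any $c$ with $0\le c<x_n$ (impossible if $x_n=0$), or (ii) to pass, in which case the prisoner must transfer the die and chooses any $c$ with $x_n\le c\le m-1$. The prisoner wins when the goal position, consisting of all $(m-1)$'s, is reached. Remoteness: $r(\beta)$ is the number of moves the game lasts starting from position $\beta$ when the prisoner tries to win as quickly as possible and the warden tries to delay the prisoner's win as long as possible. That is, $r(\beta)$ is the least $k\ge 1$ such that the prisoner has a strategy guaranteeing that, starting from $\beta$, the goal position is reached after some number $t$ of moves with $1\le t\le k$. In particular, when $\beta$ is the goal position itself, $r(\beta)$ denotes its remoteness as a starting position (the prisoner wins once the goal position is reached again after at least one move), so $r(\beta)>0$. As an ending position, the goal position is the only position of remoteness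 $0$. *)

theory Defs
  imports Main "HOL-Library.Extended_Nat"
begin

text \<open>A position \<open>x\<^sub>1 \<dots> x\<^sub>n\<close> is the list \<open>[x\<^sub>1, \<dots>, x\<^sub>n]\<close>; the rightmost die is \<open>last\<close>.\<close>

definition positions :: "nat \<Rightarrow> nat \<Rightarrow> nat list set" where
  "positions m n = {x. length x = n \<and> set x \<subseteq> {..<m}}"

definition goal :: "nat \<Rightarrow> nat \<Rightarrow> nat list" where
  "goal m n = replicate n (m - 1)"

definition transfer :: "nat \<Rightarrow> nat list \<Rightarrow> nat list" where
  "transfer c x = c # butlast x"

text \<open>
  A strategy of the prisoner maps the history of the game (all positions so far, in
  chronological order, the current one last) to the value he gives to the transferred die
  in case the warden passes. The warden's earlier choices can be read off the history: he
  passed exactly when the value of the transferred die did not decrease.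
\<close>

definition prisoner_strategy :: "nat \<Rightarrow> nat \<Rightarrow> (nat list list \<Rightarrow> nat) \<Rightarrow> bool" where
  "prisoner_strategy m n \<sigma> \<longleftrightarrow>
     (\<forall>h. h \<noteq> [] \<and> set h \<subseteq> positions m n \<longrightarrow> last (last h) \<le> \<sigma> h \<and> \<sigma> h \<le> m - 1)"

text \<open>
  The plays from \<open>\<beta>\<close> in which the prisoner follows \<open>\<sigma>\<close>: in each move the warden either
  decreases the die himself or passes. Plays are formally continued for ever, also
  after a visit to the goal position; only the times of such visits matter below.
\<close>

definition plays :: "(nat list list \<Rightarrow> nat) \<Rightarrow> nat list \<Rightarrow> (nat \<Rightarrow> nat list) set" where
  "plays \<sigma> \<beta> = {p. p 0 = \<beta> \<and>
     (\<forall>i. \<exists>c. p (Suc i) = transfer c (p i) \<and>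
            (c < last (p i) \<or> c = \<sigma> (map p [0..<Suc i])))}"

text \<open>The prisoner can guarantee that the goal is visited after some number
  \<open>t\<close> of moves with \<open>a \<le> t \<le> k\<close>.\<close>

definition can_guarantee :: "nat \<Rightarrow> nat \<Rightarrow> nat \<Rightarrow> nat \<Rightarrow> nat list \<Rightarrow> bool" where
  "can_guarantee m n a k \<beta> \<longleftrightarrow>
     (\<exists>\<sigma>. prisoner_strategy m n \<sigma> \<and>
       (\<forall>p \<in> plays \<sigma> \<beta>. \<exists>t. a \<le> t \<and> t \<le> k \<and> p t = goal m n))"

text \<open>
  Remoteness as a starting position (at least one move has to be made) and as an
  ending position (the game is over if the position is already the goal). The infimum
  of the empty set in \<^typ>\<open>enat\<close> is \<open>\<infinity>\<close>, the value when the prisoner cannot force a win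
  in any bounded number of moves.
\<close>

definition remoteness :: "nat \<Rightarrow> nat \<Rightarrow> nat list \<Rightarrow> enat" where
  "remoteness m n \<beta> = Inf {enat k | k. 1 \<le> k \<and> can_guarantee m n 1 k \<beta>}"

definition ending_remoteness :: "nat \<Rightarrow> nat \<Rightarrow> nat list \<Rightarrow> enat" where
  "ending_remoteness m n \<beta> = Inf {enat k | k. can_guarantee m n 0 k \<beta>}"

end

theory Submission
  imports Defs
begin

text \<open>
  Let \<open>W\<^sub>k\<close> be the set of positions of remoteness at most \<open>k\<close>, and \<open>E\<^sub>k = W\<^sub>k \<union> {goal}\<close>. From each
  position in \<open>W\<^sub>k\<^sub>+\<^sub>1\<close>, choose the move into \<open>E\<^sub>k\<close> with the least new value that does not decrease
  the die. This is injective: of two positions that differ only in the rightmost die, the one with the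
  larger value can be in \<open>W\<^sub>k\<^sub>+\<^sub>1\<close> only if every smaller value leads into \<open>E\<^sub>k\<close>, so the other one
  just keeps its die. Hence \<open>|W\<^sub>k\<^sub>+\<^sub>1| \<le> |E\<^sub>k| \<le> |W\<^sub>k| + 1\<close>. On the other hand
  the increasing chain \<open>W\<^sub>k\<close> can only become stationary at the set of all positions, because
  the prisoner wins from everywhere. So \<open>|W\<^sub>k| = k\<close> for \<open>k \<le> m\<^sup>n\<close>, and \<open>goal \<in> W\<^sub>k\<close> with \<open>k < m\<^sup>n\<close>
  would give \<open>|W\<^sub>k\<^sub>+\<^sub>1| \<le> |W\<^sub>k|\<close>.
\<close>

section \<open>Attractors and winning sets\<close>

definition attractor :: "nat \<Rightarrow> nat \<Rightarrow> nat list set \<Rightarrow> nat list set" where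
  "attractor m n E = {\<beta> \<in> positions m n.
     (\<forall>c < last \<beta>. transfer c \<beta> \<in> E) \<and> (\<exists>c. last \<beta> \<le> c \<and> c < m \<and> transfer c \<beta> \<in> E)}"

text \<open>\<open>k\<close> bounds the moves made from a starting position: the goal belongs to
  \<open>win m n k\<close> only if it can be forced again, whereas \<open>insert\<close> in the
  recursion ends the game on arrival there.\<close>

fun win :: "nat \<Rightarrow> nat \<Rightarrow> nat \<Rightarrow> nat list set" where
  "win m n 0 = {}"
| "win m n (Suc k) = attractor m n (insert (goal m n) (win m n k))"

lemma finite_positions: "finite (positions m n)"
  and card_positions: "card (positions m n) = m ^ n"
  using finite_lists_length_eq[of "{..<m}" n] card_lists_length_eq[of "{..<m}" n]
  by (simp_all add: positions_def conj_commute)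

lemma attractor_subset: "attractor m n E \<subseteq> positions m n"
  by (auto simp: attractor_def)

lemma attractor_mono: "E \<subseteq> E' \<Longrightarrow> attractor m n E \<subseteq> attractor m n E'"
  by (auto simp: attractor_def)

lemma win_subset: "win m n k \<subseteq> positions m n"
  by (cases k) (auto simp: attractor_def)

lemma win_mono_Suc: "win m n k \<subseteq> win m n (Suc k)"
proof (induction k)
  case (Suc k)
  then show ?case
    using attractor_mono[of "insert (goal m n) (win m n k)" "insert (goal m n) (win m n (Suc k))"]
    by auto
qed simp

lemma win_mono: "j \<le> k \<Longrightarrow> win m n j \<subseteq> win m n k"
  using lift_Suc_mono_le[of "win m n"] win_mono_Suc by blast

lemma last_less:
  assumes "\<beta> \<in> positions m n" "1 \<le> n"
  shows "last \<beta> < m"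
proof -
  have "\<beta> \<noteq> []" using assms by (auto simp: positions_def)
  then have "last \<beta> \<in> set \<beta>" by simp
  then show ?thesis using assms(1) by (auto simp: positions_def)
qed

lemma transfer_in_positions:
  assumes "\<beta> \<in> positions m n" "1 \<le> n" "c < m"
  shows "transfer c \<beta> \<in> positions m n"
  using assms by (auto simp: positions_def transfer_def dest: in_set_butlastD)

lemma goal_in_positions: "1 \<le> m \<Longrightarrow> goal m n \<in> positions m n"
  by (auto simp: goal_def positions_def)

section \<open>Size of an attractor\<close>

lemma card_attractor_le:
  assumes "finite E" "1 \<le> n"
  shows "card (attractor m n E) \<le> card E"
proof -
  define f where "f \<beta> = (LEAST c. last \<beta> \<le> c \<and> transfer c \<beta> \<in> E)" for \<beta>
  have f: "last \<beta> \<le> f \<beta> \<and> transfer (f \<beta>) \<beta> \<in> E" if "\<beta> \<in> attractor m n E" for \<beta>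
    unfolding f_def by (rule LeastI_ex) (use that in \<open>auto simp: attractor_def\<close>)
  have no_less: False
    if a: "\<alpha> \<in> attractor m n E" "\<beta> \<in> attractor m n E"
      and e: "transfer (f \<alpha>) \<alpha> = transfer (f \<beta>) \<beta>" and l: "last \<alpha> < last \<beta>" for \<alpha> \<beta>
  proof -
    have b: "butlast \<alpha> = butlast \<beta>" "f \<alpha> = f \<beta>" using e by (auto simp: transfer_def)
    \<comment> \<open>As \<open>\<beta>\<close> agrees with \<open>\<alpha>\<close> in all other
      dice, this is the warden lowering the last die of \<open>\<beta>\<close> to
      \<open>last \<alpha>\<close>, which stays in \<open>E\<close>.\<close>
    have "transfer (last \<alpha>) \<alpha> \<in> E"
      using a(2) l b(1) by (auto simp: attractor_def transfer_def)
    then have "f \<alpha> \<le> last \<alpha>" unfolding f_def by (intro Least_le) auto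
    then show False using f[OF a(2)] l b(2) by auto
  qed
  have "inj_on (\<lambda>\<beta>. transfer (f \<beta>) \<beta>) (attractor m n E)"
  proof (rule inj_onI)
    fix \<alpha> \<beta> assume a: "\<alpha> \<in> attractor m n E" "\<beta> \<in> attractor m n E"
      and e: "transfer (f \<alpha>) \<alpha> = transfer (f \<beta>) \<beta>"
    have "last \<alpha> = last \<beta>"
      using no_less[OF a e] no_less[OF a(2,1) e[symmetric]] by (meson linorder_neqE_nat)
    moreover have "butlast \<alpha> = butlast \<beta>" using e by (auto simp: transfer_def)
    moreover have "\<alpha> \<noteq> []" "\<beta> \<noteq> []" using a assms(2) by (auto simp: attractor_def positions_def)
    ultimately show "\<alpha> = \<beta>" by (metis append_butlast_last_id)
  qed
  then show ?thesis using assms(1) f by (intro card_inj_on_le[of "\<lambda>\<beta>. transfer (f \<beta>) \<beta>"]) auto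
qed

section \<open>Lexicographic descent and attractor-closed sets\<close>

text \<open>The first difference is a decrease: between \<open>d\<close> and \<open>u\<close> or, if
  these agree, from \<open>x\<close> to \<open>c\<close>.\<close>

lemma lex_less_if_pointwise_le:
  assumes "list_all2 (\<le>) d u" "(c::nat) < x" "length s = length t"
  shows "(d @ c # s, u @ x # t) \<in> lex less_than"
  using assms(1)
proof (induction rule: list_all2_induct)
  case Nil
  then show ?case using assms(2,3) by simp
next
  case (Cons a d b u)
  then show ?case using assms(3) by (auto simp: list_all2_lengthD)
qed

text \<open>The dice of \<open>u\<close> are transferred in turn, starting from the right, to values
  given by \<open>step\<close>; they arrive to the left of \<open>z\<close> in their old
  order.\<close>

lemma rotate_decreasing:
  fixes L :: "nat list set"
  assumes step: "\<And>y x. y @ [x] \<in> L \<Longrightarrow> \<exists>c\<le>x. c # y \<in> L"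
  shows "z @ u \<in> L \<Longrightarrow> \<exists>d. list_all2 (\<le>) d u \<and> d @ z \<in> L"
proof (induction u arbitrary: z rule: rev_induct)
  case (snoc x u)
  obtain c where c: "c \<le> x" "(c # z) @ u \<in> L" using step[of "z @ u" x] snoc.prems by auto
  obtain d where "list_all2 (\<le>) d u" "d @ c # z \<in> L" using snoc.IH[OF c(2)] by auto
  then show ?case using c(1) by (intro exI[of _ "d @ [c]"]) (auto intro: list_all2_appendI)
qed auto

text \<open>
  If the complement \<open>L\<close> of \<open>E\<close> is nonempty, let \<open>w\<close> be its lexicographically least element.
  Set the dice of \<open>w\<close> to \<open>m - 1\<close> one after another. If the warden could stay in \<open>L\<close> by decreasing
  a die on the way, then moving the remaining dice of \<open>w\<close> inside \<open>L\<close> without any increase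
  would end in an element of \<open>L\<close> below \<open>w\<close>. So he can only stay in \<open>L\<close> by passing, against
  every reply of the prisoner, and this would put the goal into \<open>L\<close>.
\<close>

lemma positions_subset_if_attractor_subset:
  assumes mn: "1 \<le> n" and goal: "goal m n \<in> E" and closed: "attractor m n E \<subseteq> E"
  shows "positions m n \<subseteq> E"
proof (rule ccontr)
  define L where "L = positions m n - E"
  assume "\<not> positions m n \<subseteq> E"
  then obtain w0 where "w0 \<in> L" by (auto simp: L_def)
  then obtain w where w: "w \<in> L" and w_min: "\<And>v. (v, w) \<in> lex less_than \<Longrightarrow> v \<notin> L"
    using wfE_min[OF wf_lex[OF wf_less_than]] by metis
  have len: "length v = n" if "v \<in> L" for v using that by (auto simp: L_def positions_def)
  have escape: "(\<exists>c<x. c # y \<in> L) \<or> (\<forall>c. x \<le> c \<and> c < m \<longrightarrow> c # y \<in> L)" and x_less: "x < m"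
    if yx: "y @ [x] \<in> L" for y x
  proof -
    have pos: "y @ [x] \<in> positions m n" and "y @ [x] \<notin> attractor m n E"
      using yx closed by (auto simp: L_def)
    then have "(\<exists>c<x. c # y \<notin> E) \<or> (\<forall>c. x \<le> c \<and> c < m \<longrightarrow> c # y \<notin> E)"
      by (auto simp: attractor_def transfer_def)
    moreover show "x < m" using last_less[OF pos mn] by simp
    moreover have "c # y \<in> positions m n" if "c < m" for c
      using transfer_in_positions[OF pos mn that] by (simp add: transfer_def)
    ultimately show "(\<exists>c<x. c # y \<in> L) \<or> (\<forall>c. x \<le> c \<and> c < m \<longrightarrow> c # y \<in> L)"
      unfolding L_def by (meson Diff_iff less_trans)
  qed
  \<comment> \<open>Where no decrease stays in \<open>L\<close>, keeping the value \<open>x\<close>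
    does, since \<open>x < m\<close>.\<close>
  have step: "\<exists>c\<le>x. c # y \<in> L" if "y @ [x] \<in> L" for y x
    using escape[OF that] x_less[OF that] by (meson order_refl less_imp_le)
  have "replicate j (m - 1) @ take (n - j) w \<in> L" if "j \<le> n" for j
    using that
  proof (induction j)
    case 0
    then show ?case using w len[OF w] by simp
  next
    case (Suc j)
    define i where "i = n - Suc j"
    let ?r = "replicate j (m - 1)"
    have i: "n - j = Suc i" "i < length w" using Suc.prems len[OF w] by (auto simp: i_def)
    have mem: "(?r @ take i w) @ [w ! i] \<in> L"
      using Suc i by (simp add: take_Suc_conv_app_nth)
    have "c # ?r @ take i w \<notin> L" if c: "c < w ! i" for c
    proof
      assume "c # ?r @ take i w \<in> L"
      then obtain d where d: "list_all2 (\<le>) d (take i w)" "d @ c # ?r \<in> L"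
        using rotate_decreasing[of L "c # ?r" "take i w"] step by auto
      \<comment> \<open>One full rotation of \<open>w\<close> is now complete, so \<open>d\<close>
        and \<open>c\<close> stand in the places of \<open>take i w\<close> and
        \<open>w ! i\<close>.\<close>
      have "(d @ c # ?r, take i w @ w ! i # drop (Suc i) w) \<in> lex less_than"
        using d(1) c i len[OF w] by (intro lex_less_if_pointwise_le) auto
      then show False using w_min d(2) i(2) by (simp add: id_take_nth_drop[symmetric])
    qed
    then have "(m - 1) # ?r @ take i w \<in> L"
      using escape[OF mem] x_less[OF mem] by auto
    then show ?case by (simp add: i_def)
  qed
  from this[of n] show False using goal by (simp add: L_def goal_def)
qed

lemma attractor_positions:
  assumes "1 \<le> n" "positions m n \<subseteq> E"
  shows "attractor m n E = positions m n"
proof -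
  have "\<beta> \<in> attractor m n E" if "\<beta> \<in> positions m n" for \<beta>
    using last_less[OF that assms(1)] transfer_in_positions[OF that assms(1)] that assms(2)
    unfolding attractor_def by (auto intro: less_trans)
  then show ?thesis using attractor_subset by blast
qed

section \<open>Exact sizes of the winning sets\<close>

text \<open>Stationarity makes \<open>insert (goal m n) (win m n k)\<close> closed under the
  attractor, so it contains every position. One further attractor step, which gives
  \<open>win m n k\<close> again, then contains the goal as well.\<close>

lemma win_eq_positions_if_stationary:
  assumes "1 \<le> n" "win m n (Suc k) = win m n k"
  shows "win m n k = positions m n"
proof -
  let ?E = "insert (goal m n) (win m n k)"
  have "positions m n \<subseteq> ?E"
    using assms by (intro positions_subset_if_attractor_subset) auto
  then show ?thesis using attractor_positions[OF assms(1)] assms(2) by simp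
qed

lemma finite_win: "finite (win m n k)"
  using finite_subset[OF win_subset finite_positions] .

lemma card_win_le: "1 \<le> n \<Longrightarrow> card (win m n k) \<le> k"
proof (induction k)
  case (Suc k)
  have "card (win m n (Suc k)) \<le> card (insert (goal m n) (win m n k))"
    using card_attractor_le[OF _ Suc.prems] finite_win by simp
  also have "\<dots> \<le> Suc (card (win m n k))"
    by (simp add: card_insert_if finite_win)
  finally show ?case using Suc by simp
qed simp

text \<open>Below \<open>m ^ n\<close> the sets grow strictly, hence by at least one per step;
  \<open>card_win_le\<close> allows no more.\<close>

lemma card_win:
  assumes "1 \<le> n" "k \<le> m ^ n"
  shows "card (win m n k) = k"
proof -
  have "k \<le> card (win m n k)" using assms(2)
  proof (induction k)
    case (Suc k)
    have "card (win m n k) = k"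
      using Suc card_win_le[OF assms(1), of m k] by simp
    then have "win m n k \<noteq> positions m n" using Suc.prems card_positions[of m n] by auto
    then have "win m n k \<subset> win m n (Suc k)"
      using win_eq_positions_if_stationary[OF assms(1)] win_mono_Suc by blast
    from psubset_card_mono[OF finite_win this] show ?case using Suc by simp
  qed simp
  then show ?thesis using card_win_le[OF assms(1), of m k] by simp
qed

lemma win_all: "1 \<le> n \<Longrightarrow> win m n (m ^ n) = positions m n"
  using card_win[of n "m ^ n" m] card_positions[of m n] win_subset finite_positions
  by (intro card_subset_eq) auto

lemma goal_notin_win:
  assumes "1 \<le> n" "k < m ^ n"
  shows "goal m n \<notin> win m n k"
proof
  assume "goal m n \<in> win m n k"
  then have "card (win m n (Suc k)) \<le> card (win m n k)"
    using card_attractor_le[OF finite_win assms(1)] by (simp add: insert_absorb)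
  then show False using card_win[OF assms(1), of k m] card_win[OF assms(1), of "Suc k" m] assms(2) by simp
qed

section \<open>Plays, strategies and winning sets\<close>

lemma plays_nonempty: "plays \<sigma> \<beta> \<noteq> {}"
proof -
  \<comment> \<open>\<open>h i\<close> is the history after \<open>i\<close> moves when the warden
    always passes.\<close>
  define h where "h i = ((\<lambda>h. h @ [transfer (\<sigma> h) (last h)]) ^^ i) [\<beta>]" for i
  have h: "h (Suc i) = h i @ [transfer (\<sigma> (h i)) (last (h i))]" for i by (simp add: h_def)
  have "map (\<lambda>i. last (h i)) [0..<Suc i] = h i" for i
    by (induction i) (simp_all add: h, simp add: h_def)
  then have "(\<lambda>i. last (h i)) \<in> plays \<sigma> \<beta>"
    by (auto simp: plays_def h) (simp add: h_def)
  then show ?thesis by blast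
qed

text \<open>Lets an induction peel off the first move: the continuation is played with
  \<open>\<sigma>\<close> remembering \<open>\<beta>\<close> at the head of its history.\<close>

lemma plays_Cons:
  assumes "p \<in> plays (\<lambda>h. \<sigma> (\<beta> # h)) (transfer c \<beta>)" "c < last \<beta> \<or> c = \<sigma> [\<beta>]"
  shows "case_nat \<beta> p \<in> plays \<sigma> \<beta>"
proof -
  have h: "map (case_nat \<beta> p) [0..<Suc i] = \<beta> # map p [0..<i]" for i
    by (simp add: upt_conv_Cons map_Suc_upt[symmetric] o_def del: upt_Suc)
  have "\<exists>c. case_nat \<beta> p (Suc i) = transfer c (case_nat \<beta> p i) \<and>
      (c < last (case_nat \<beta> p i) \<or> c = \<sigma> (map (case_nat \<beta> p) [0..<Suc i]))" for i
    unfolding h using assms by (cases i) (auto simp: plays_def simp del: upt_Suc)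
  then show ?thesis by (simp add: plays_def del: upt_Suc)
qed

lemma play_avoiding_goal:
  assumes "prisoner_strategy m n \<sigma>" "\<beta> \<in> positions m n" "\<beta> \<notin> win m n k" "1 \<le> n"
  shows "\<exists>p \<in> plays \<sigma> \<beta>. \<forall>t. 1 \<le> t \<and> t \<le> k \<longrightarrow> p t \<noteq> goal m n"
  using assms
proof (induction k arbitrary: \<sigma> \<beta>)
  case 0
  then show ?case using plays_nonempty[of \<sigma> \<beta>] by auto
next
  case (Suc k)
  let ?E = "insert (goal m n) (win m n k)"
  have last: "last \<beta> < m" using last_less Suc.prems by blast
  have sig: "last \<beta> \<le> \<sigma> [\<beta>]" "\<sigma> [\<beta>] < m"
    using Suc.prems(1,2) last unfolding prisoner_strategy_def by (force dest!: spec[of _ "[\<beta>]"])+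
  \<comment> \<open>Outside the attractor of \<open>?E\<close>, either some decrease avoids
    \<open>?E\<close> or every legal reply does, in particular
    \<open>\<sigma> [\<beta>]\<close>.\<close>
  obtain c where c: "c < last \<beta> \<or> c = \<sigma> [\<beta>]" "transfer c \<beta> \<notin> ?E"
    using Suc.prems(2,3) sig by (auto simp: attractor_def)
  have "c < m" using c last sig by auto
  then have pos: "transfer c \<beta> \<in> positions m n" using transfer_in_positions Suc.prems by blast
  have strat: "prisoner_strategy m n (\<lambda>h. \<sigma> (\<beta> # h))"
    unfolding prisoner_strategy_def
  proof (intro allI impI)
    fix h assume h: "h \<noteq> [] \<and> set h \<subseteq> positions m n"
    then show "last (last h) \<le> \<sigma> (\<beta> # h) \<and> \<sigma> (\<beta> # h) \<le> m - 1"
      using Suc.prems(1,2) unfolding prisoner_strategy_def by (auto dest!: spec[of _ "\<beta> # h"])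
  qed
  obtain p where p: "p \<in> plays (\<lambda>h. \<sigma> (\<beta> # h)) (transfer c \<beta>)"
    and avoid: "\<forall>t. 1 \<le> t \<and> t \<le> k \<longrightarrow> p t \<noteq> goal m n"
    using Suc.IH[OF strat pos _ Suc.prems(4)] c(2) by auto
  have "p 0 \<noteq> goal m n" using p c(2) by (auto simp: plays_def)
  then have "\<forall>t. 1 \<le> t \<and> t \<le> Suc k \<longrightarrow> case_nat \<beta> p t \<noteq> goal m n"
    using avoid by (auto split: nat.split) (metis One_nat_def Suc_leI neq0_conv)
  then show ?case using plays_Cons[OF p c(1)] by blast
qed

text \<open>A reply that works for the least \<open>k\<close> works for all larger ones, as the
  winning sets increase. Hence a strategy can look at the current position alone, without a move
  counter.\<close>

lemma ex_uniform_reply: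
  assumes "\<beta> \<in> positions m n" "1 \<le> n"
  shows "\<exists>c. last \<beta> \<le> c \<and> c < m \<and>
    (\<forall>k. \<beta> \<in> win m n (Suc k) \<longrightarrow> transfer c \<beta> \<in> insert (goal m n) (win m n k))"
proof (cases "\<exists>k. \<beta> \<in> win m n (Suc k)")
  case True
  define k0 where "k0 = (LEAST k. \<beta> \<in> win m n (Suc k))"
  have "\<beta> \<in> win m n (Suc k0)" unfolding k0_def using True by (rule LeastI_ex)
  then obtain c where c: "last \<beta> \<le> c" "c < m" "transfer c \<beta> \<in> insert (goal m n) (win m n k0)"
    by (auto simp: attractor_def)
  have "transfer c \<beta> \<in> insert (goal m n) (win m n k)" if "\<beta> \<in> win m n (Suc k)" for k
  proof -
    have "k0 \<le> k" unfolding k0_def using that by (rule Least_le)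
    then show ?thesis using c(3) win_mono by blast
  qed
  then show ?thesis using c by blast
next
  case False
  then show ?thesis using last_less[OF assms] by blast
qed

lemma can_guarantee_if_win:
  assumes "\<beta> \<in> win m n k" "1 \<le> n"
  shows "can_guarantee m n 1 k \<beta>"
proof -
  obtain g where g: "\<And>\<beta>. \<beta> \<in> positions m n \<Longrightarrow> last \<beta> \<le> g \<beta> \<and> g \<beta> < m \<and>
      (\<forall>k. \<beta> \<in> win m n (Suc k) \<longrightarrow> transfer (g \<beta>) \<beta> \<in> insert (goal m n) (win m n k))"
    using ex_uniform_reply[OF _ assms(2), of _ m] by metis
  define \<sigma> where "\<sigma> h = g (last h)" for h
  have "prisoner_strategy m n \<sigma>"
    unfolding prisoner_strategy_def \<sigma>_def
  proof (intro allI impI)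
    fix h assume "h \<noteq> [] \<and> set h \<subseteq> positions m n"
    then have "last h \<in> positions m n" using last_in_set by blast
    from g[OF this] show "last (last h) \<le> g (last h) \<and> g (last h) \<le> m - 1" by auto
  qed
  moreover
  \<comment> \<open>Stated for every time \<open>i\<close>: the strategy is positional, so the
    induction on \<open>k\<close> moves along one fixed play.\<close>
  have "\<exists>t. 1 \<le> t \<and> t \<le> k \<and> p (i + t) = goal m n"
    if p: "p \<in> plays \<sigma> \<beta>" and pi: "p i \<in> win m n k" for p i k \<beta>
    using pi
  proof (induction k arbitrary: i)
    case (Suc k)
    obtain c where c: "p (Suc i) = transfer c (p i)" "c < last (p i) \<or> c = g (p i)"
      using p by (auto simp: plays_def \<sigma>_def)
    have "p i \<in> positions m n" using Suc.prems win_subset by blast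
    from g[OF this] have "p (Suc i) \<in> insert (goal m n) (win m n k)"
      using c Suc.prems by (auto simp: attractor_def)
    then show ?case
    proof
      assume "p (Suc i) = goal m n"
      then show ?thesis by (intro exI[of _ 1]) auto
    next
      assume "p (Suc i) \<in> win m n k"
      then obtain t where "1 \<le> t" "t \<le> k" "p (Suc i + t) = goal m n" using Suc.IH by blast
      then show ?thesis by (intro exI[of _ "Suc t"]) auto
    qed
  qed simp
  from this[of _ \<beta> 0 k] have "\<exists>t. 1 \<le> t \<and> t \<le> k \<and> p t = goal m n" if "p \<in> plays \<sigma> \<beta>" for p
    using that assms(1) by (simp add: plays_def)
  ultimately show ?thesis unfolding can_guarantee_def by blast
qed

lemma can_guarantee_iff_win:
  assumes "\<beta> \<in> positions m n" "1 \<le> n"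
  shows "can_guarantee m n 1 k \<beta> \<longleftrightarrow> \<beta> \<in> win m n k"
proof
  assume "can_guarantee m n 1 k \<beta>"
  then obtain \<sigma> where \<sigma>: "prisoner_strategy m n \<sigma>"
    and reach: "\<forall>p \<in> plays \<sigma> \<beta>. \<exists>t. 1 \<le> t \<and> t \<le> k \<and> p t = goal m n"
    by (auto simp: can_guarantee_def)
  show "\<beta> \<in> win m n k"
    using play_avoiding_goal[OF \<sigma> assms(1) _ assms(2), of k] reach by blast
qed (rule can_guarantee_if_win[OF _ assms(2)])

section \<open>Remoteness in terms of winning sets\<close>

text \<open>A finite bound forces the set to be nonempty, and in the well-ordered
  \<open>enat\<close> its infimum is then attained.\<close>

lemma Inf_enat_le_iff: "Inf {enat k | k. P k} \<le> enat j \<longleftrightarrow> (\<exists>k\<le>j. P k)"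
proof
  assume le: "Inf {enat k | k. P k} \<le> enat j"
  have "{enat k | k. P k} \<noteq> {}"
  proof
    assume "{enat k | k. P k} = {}"
    then have "Inf {enat k | k. P k} = \<infinity>" by (simp only: Inf_empty top_enat_def)
    then show False using le by simp
  qed
  then obtain e where "e \<in> {enat k | k. P k}" by blast
  from wellorder_InfI[OF this] obtain k where "Inf {enat k | k. P k} = enat k" "P k" by blast
  then show "\<exists>k\<le>j. P k" using le by auto
next
  assume "\<exists>k\<le>j. P k"
  then show "Inf {enat k | k. P k} \<le> enat j" by (auto intro: Inf_lower2)
qed

lemma remoteness_le_iff:
  assumes "\<beta> \<in> positions m n" "1 \<le> n"
  shows "remoteness m n \<beta> \<le> enat k \<longleftrightarrow> \<beta> \<in> win m n k"
proof -
  have "remoteness m n \<beta> \<le> enat k \<longleftrightarrow> (\<exists>j\<le>k. 1 \<le> j \<and> \<beta> \<in> win m n j)"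
    unfolding remoteness_def can_guarantee_iff_win[OF assms] by (rule Inf_enat_le_iff)
  \<comment> \<open>The witness \<open>j = k\<close> is legitimate because \<open>win m n 0\<close>
    is empty.\<close>
  moreover have "1 \<le> k" if "\<beta> \<in> win m n k" using that by (cases k) auto
  ultimately show ?thesis using win_mono by blast
qed

lemma remoteness_eq_Suc_iff:
  assumes "\<beta> \<in> positions m n" "1 \<le> n"
  shows "remoteness m n \<beta> = enat (Suc k) \<longleftrightarrow> \<beta> \<in> win m n (Suc k) - win m n k"
proof -
  have "e = enat (Suc k) \<longleftrightarrow> e \<le> enat (Suc k) \<and> \<not> e \<le> enat k" for e
    by (cases e) auto
  then show ?thesis by (simp only: Diff_iff remoteness_le_iff[OF assms])
qed

text \<open>Only the initial position counts here; as some play always exists, the guarantee is not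
  vacuous. Conversely, any legal strategy will do, such as always choosing
  \<open>m - 1\<close>.\<close>

lemma can_guarantee_now_iff: "can_guarantee m n 0 0 \<beta> \<longleftrightarrow> \<beta> = goal m n" if "1 \<le> n"
proof
  assume "can_guarantee m n 0 0 \<beta>"
  then obtain \<sigma> where "\<forall>p \<in> plays \<sigma> \<beta>. p 0 = goal m n"
    by (auto simp: can_guarantee_def)
  then show "\<beta> = goal m n" using plays_nonempty[of \<sigma> \<beta>] by (auto simp: plays_def)
next
  assume \<beta>: "\<beta> = goal m n"
  have "prisoner_strategy m n (\<lambda>h. m - 1)"
    unfolding prisoner_strategy_def
  proof (intro allI impI)
    fix h assume "h \<noteq> [] \<and> set h \<subseteq> positions m n"
    then have "last h \<in> positions m n" using last_in_set by blast
    from last_less[OF this that] show "last (last h) \<le> m - 1 \<and> m - 1 \<le> m - 1" by simp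
  qed
  then show "can_guarantee m n 0 0 \<beta>" using \<beta> by (auto simp: can_guarantee_def plays_def)
qed

lemma ending_remoteness_eq_0_iff:
  assumes "1 \<le> n"
  shows "ending_remoteness m n \<beta> = 0 \<longleftrightarrow> \<beta> = goal m n"
proof -
  have "ending_remoteness m n \<beta> = 0 \<longleftrightarrow> ending_remoteness m n \<beta> \<le> enat 0"
    by (simp add: zero_enat_def[symmetric])
  also have "\<dots> \<longleftrightarrow> \<beta> = goal m n"
    unfolding ending_remoteness_def Inf_enat_le_iff using can_guarantee_now_iff[OF assms] by simp
  finally show ?thesis .
qed

theorem theorem4:
  fixes m n :: nat
  assumes "1 \<le> m" and "1 \<le> n"
  shows "(\<forall>\<beta> \<in> positions m n. ending_remoteness m n \<beta> = 0 \<longleftrightarrow> \<beta> = goal m n) \<and>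
    (\<forall>\<beta> \<in> positions m n. 0 < remoteness m n \<beta> \<and> remoteness m n \<beta> \<le> enat (m ^ n)) \<and>
    (\<forall>j. 1 \<le> j \<and> j \<le> m ^ n \<longrightarrow> (\<exists>!\<beta>. \<beta> \<in> positions m n \<and> remoteness m n \<beta> = enat j)) \<and>
    goal m n \<in> positions m n \<and> remoteness m n (goal m n) = enat (m ^ n)"
proof (intro conjI ballI allI impI)
  fix \<beta> assume \<beta>: "\<beta> \<in> positions m n"
  show "ending_remoteness m n \<beta> = 0 \<longleftrightarrow> \<beta> = goal m n"
    by (rule ending_remoteness_eq_0_iff[OF assms(2)])
  show "0 < remoteness m n \<beta>"
    using remoteness_le_iff[OF \<beta> assms(2), of 0] by (simp add: zero_enat_def[symmetric])
  show "remoteness m n \<beta> \<le> enat (m ^ n)"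
    using remoteness_le_iff[OF \<beta> assms(2)] win_all[OF assms(2)] \<beta> by simp
next
  fix j assume j: "1 \<le> j \<and> j \<le> m ^ n"
  then obtain k where k: "j = Suc k" by (cases j) auto
  have "card (win m n (Suc k) - win m n k) = 1"
    using card_Diff_subset[OF finite_win win_mono_Suc, of m n k] j k
      card_win[OF assms(2), of k m] card_win[OF assms(2), of "Suc k" m] by (simp del: win.simps)
  then obtain \<alpha> where \<alpha>: "win m n (Suc k) - win m n k = {\<alpha>}" by (rule card_1_singletonE)
  then have "\<alpha> \<in> positions m n" using win_subset by blast
  moreover have "remoteness m n \<beta> = enat j \<longleftrightarrow> \<beta> = \<alpha>" if "\<beta> \<in> positions m n" for \<beta>
    unfolding k remoteness_eq_Suc_iff[OF that assms(2)] \<alpha> by simp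
  ultimately show "\<exists>!\<beta>. \<beta> \<in> positions m n \<and> remoteness m n \<beta> = enat j" by metis
next
  show goal: "goal m n \<in> positions m n" using goal_in_positions[OF assms(1)] .
  \<comment> \<open>The goal lies in \<open>win m n (Suc k)\<close>, which is everything, but not in
    \<open>win m n k\<close>.\<close>
  obtain k where k: "m ^ n = Suc k" using assms(1) by (cases "m ^ n") auto
  then show "remoteness m n (goal m n) = enat (m ^ n)"
    using remoteness_eq_Suc_iff[OF goal assms(2), of k] goal_notin_win[OF assms(2), of k m]
      win_all[OF assms(2), of m] goal by (simp del: win.simps)
qed

end
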